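(* Let $n\ge 1$. For all $A,B\in\mathbb{R}^n$, $$d_{\text{peak}}(A,B)=d_{\mathrm{Tan}}\bigl(\phi(A),\phi(B)\bigr),$$ where $d_{\mathrm{Tan}}$ is the Tanimoto distance on $\mathbb{R}_{\ge 0}^{2n}$. Consequently, $d_{\text{peak}}$ is a metric on $\mathbb{R}^n$.
   Context: For a real number $x$, write $x^+=\max\{x,0\}$ and $x^-=\max\{-x,0\}$; $\operatorname{sgn}(x)\in\{-1,0,+1\}$ is the sign function. Sign-split embedding: $\phi:\mathbb{R}^n\to\mathbb{R}_{\ge 0}^{2n}$, $\phi(x_1,\dots,x_n)=(x_1^+,x_1^-,x_2^+,x_2^-,\dots,x_n^+,x_n^-)$. For $A=(A_1,\dots,A_n)$, $B=(B_1,\dots,B_n)\in\mathbb{R}^n$: - $\mathcal{I}_{\text{same}}(A,B)=\{i\in\{1,\dots,n\} : \operatorname{sgn}(A_i)=\operatorname{sgn}(B_i)\neq 0\}$; - sign-aware intersection: $N(A,B)=\sum_{i\in\mathcal{I}_{\text{same}}(A,B)}\min(|A_i|,|B_i|)$; - peak-to-peak union: $U_{\text{peak}}(A,B)=\sum_{i=1}^n\bigl(\max\{A_i^+,B_i^+\}+\max\{A_i^-,B_i^-\}\bigr)$; - peak-to-peak similarity: $J_{\text{peak}}(A,B)=N(A,B)/U_{\text{peak}}(A,B)$ if $U_{\text{peak}}(A,B)>0$, and $J_{\text{peak}}(A,B)=1$ if $U_{\text{peak}}(A,B)=0$; - peak-to-peak distance: $d_{\text{peak}}(A,B)=1-J_{\text{peak}}(A,B)$.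 Tanimoto (generalized Jaccard) similarity and distance: for $U,V\in\mathbb{R}_{\ge 0}^{d}$, $J_{\mathrm{Tan}}(U,V)=\dfrac{\sum_j\min\{U_j,V_j\}}{\sum_j\max\{U_j,V_j\}}$ if $\sum_j\max\{U_j,V_j\}>0$, and $J_{\mathrm{Tan}}(U,V)=1$ if $U=V=0$; $d_{\mathrm{Tan}}(U,V)=1-J_{\mathrm{Tan}}(U,V)$. *)

theory Defs
  imports "HOL-Analysis.Analysis"
begin

definition pos_part :: "real \<Rightarrow> real" where
  "pos_part x = max x 0"

definition neg_part :: "real \<Rightarrow> real" where
  "neg_part x = max (- x) 0"

text \<open>
  The space of real vectors of length \<open>2 n\<close> is modelled by the index type \<open>'n \<times> bool\<close>, which has
  \<open>2 * CARD('n)\<close> elements: the coordinates \<open>(i, True)\<close> and \<open>(i, False)\<close> are the two consecutive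
  entries \<open>x\<^sub>i\<^sup>+\<close> and \<open>x\<^sub>i\<^sup>-\<close> of the sign-split vector.
\<close>

definition sign_split :: "real ^ 'n \<Rightarrow> real ^ ('n \<times> bool)" where
  "sign_split x = (\<chi> j. if snd j then pos_part (x $ fst j) else neg_part (x $ fst j))"

definition I_same :: "real ^ 'n \<Rightarrow> real ^ 'n \<Rightarrow> 'n set" where
  "I_same A B = {i. sgn (A $ i) = sgn (B $ i) \<and> sgn (B $ i) \<noteq> 0}"

definition N_sign :: "real ^ 'n \<Rightarrow> real ^ 'n \<Rightarrow> real" where
  "N_sign A B = (\<Sum>i\<in>I_same A B. min \<bar>A $ i\<bar> \<bar>B $ i\<bar>)"

definition U_peak :: "real ^ 'n \<Rightarrow> real ^ 'n \<Rightarrow> real" where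
  "U_peak A B = (\<Sum>i\<in>UNIV. max (pos_part (A $ i)) (pos_part (B $ i))
                          + max (neg_part (A $ i)) (neg_part (B $ i)))"

text \<open>\<open>U_peak\<close> is never negative, so the second branch is exactly the case \<open>U_peak A B = 0\<close>.\<close>

definition J_peak :: "real ^ 'n \<Rightarrow> real ^ 'n \<Rightarrow> real" where
  "J_peak A B = (if U_peak A B > 0 then N_sign A B / U_peak A B else 1)"

definition d_peak :: "real ^ 'n \<Rightarrow> real ^ 'n \<Rightarrow> real" where
  "d_peak A B = 1 - J_peak A B"

definition nonneg_orthant :: "(real ^ 'd) set" where
  "nonneg_orthant = {U. \<forall>j. 0 \<le> U $ j}"

text \<open>
  The Tanimoto similarity is meaningful on \<open>nonneg_orthant\<close> only. There the second branch is exactly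
  the case \<open>U = V = 0\<close>; see \<open>sum_max_pos_iff\<close> below.
\<close>

definition J_Tan :: "real ^ 'd \<Rightarrow> real ^ 'd \<Rightarrow> real" where
  "J_Tan U V =
    (if (\<Sum>j\<in>UNIV. max (U $ j) (V $ j)) > 0
     then (\<Sum>j\<in>UNIV. min (U $ j) (V $ j)) / (\<Sum>j\<in>UNIV. max (U $ j) (V $ j))
     else 1)"

definition d_Tan :: "real ^ 'd \<Rightarrow> real ^ 'd \<Rightarrow> real" where
  "d_Tan U V = 1 - J_Tan U V"

lemma U_peak_nonneg: "0 \<le> U_peak A B"
  unfolding U_peak_def pos_part_def neg_part_def by (intro sum_nonneg) auto

lemma sum_max_pos_iff:
  fixes U V :: "real ^ 'd"
  assumes "U \<in> nonneg_orthant" "V \<in> nonneg_orthant"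
  shows "(\<Sum>j\<in>UNIV. max (U $ j) (V $ j)) > 0 \<longleftrightarrow> \<not> (U = 0 \<and> V = 0)"
proof -
  have nn: "0 \<le> U $ j" "0 \<le> V $ j" for j
    using assms by (auto simp: nonneg_orthant_def)
  have nm: "0 \<le> max (U $ j) (V $ j)" for j
    using nn(1)[of j] by simp
  have "max (U $ j) (V $ j) = 0 \<longleftrightarrow> U $ j = 0 \<and> V $ j = 0" for j
    using nn[of j] by (auto simp: max_def)
  then have "(\<Sum>j\<in>UNIV. max (U $ j) (V $ j)) = 0 \<longleftrightarrow> U = 0 \<and> V = 0"
    by (auto simp: sum_nonneg_eq_0_iff nm vec_eq_iff)
  moreover have "0 \<le> (\<Sum>j\<in>UNIV. max (U $ j) (V $ j))"
    by (intro sum_nonneg nm)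
  ultimately show ?thesis by linarith
qed

lemma sign_split_nonneg: "sign_split x \<in> nonneg_orthant"
  by (auto simp: sign_split_def nonneg_orthant_def pos_part_def neg_part_def)

end

(* On nonnegative vectors, max(u,v) = (u + v + |u - v|) / 2 and min(u,v) = max(u,v) - |u - v|, so the
   Tanimoto distance is 2 d(U,V) / (d(U,0) + d(V,0) + d(U,V)) for the l1 distance d. This is the
   Steinhaus transform of d with base point 0, which turns metrics into metrics. The sign-split
   embedding is injective and carries the peak-to-peak distance to the Tanimoto distance. *)
theory Submission
  imports Defs
begin

text \<open>For the triangle inequality, \<open>s / (c + s)\<close> increases with \<open>s\<close>,
  so \<open>d x z\<close> may be replaced by \<open>d x y + d y z\<close>. The resulting common
  denominator bounds both denominators on the right, by the triangle inequality through
  \<open>a\<close>.\<close>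

lemma Metric_space_Steinhaus_transform:
  assumes "Metric_space M d" and a: "a \<in> M"
  shows "Metric_space M (\<lambda>x y. 2 * d x y / (d x a + d y a + d x y))"
proof -
  interpret Metric_space M d by fact
  show ?thesis
  proof
    fix x y
    show "0 \<le> 2 * d x y / (d x a + d y a + d x y)" by simp
    show "2 * d x y / (d x a + d y a + d x y) = 2 * d y x / (d y a + d x a + d y x)"
      by (simp add: commute add.commute)
  next
    fix x y assume xy: "x \<in> M" "y \<in> M"
    \<comment> \<open>A zero denominator forces \<open>d x y = 0\<close>; division by zero then
      returns 0, the right value.\<close>
    have "d x y = 0 \<or> 0 < d x a + d y a + d x y"
      using nonneg[of x y] nonneg[of x a] nonneg[of y a] by linarith
    then show "2 * d x y / (d x a + d y a + d x y) = 0 \<longleftrightarrow> x = y"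
      using zero[OF xy] by auto
  next
    fix x y z assume xyz: "x \<in> M" "y \<in> M" "z \<in> M"
    define c where "c = d x a + d z a"
    define q where "q = d x y"
    define r where "r = d y z"
    have nn: "0 \<le> c" "0 \<le> q" "0 \<le> r" "0 \<le> d x z" "0 \<le> d y a" "0 \<le> d x a" "0 \<le> d z a"
      by (simp_all add: c_def q_def r_def)
    have tri: "d x z \<le> q + r" "d y a \<le> d z a + r" "d y a \<le> d x a + q"
      using triangle[of x y z] triangle[of y z a] triangle[of y x a] xyz a
      by (simp_all add: q_def r_def commute)
    \<comment> \<open>The case \<open>s = 0\<close> is separate because \<open>t\<close> may then be
      0; otherwise \<open>s \<le> t\<close> makes both denominators positive.\<close>
    have weaken: "2 * s / (c + q + r) \<le> 2 * s / t" if "0 \<le> s" "s \<le> t" "t \<le> c + q + r" for s t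
      using that by (cases "s = 0") (auto intro!: divide_left_mono mult_pos_pos)
    \<comment> \<open>After cross-multiplication this is
      \<open>c * d x z \<le> c * (q + r)\<close>.\<close>
    have "2 * d x z / (c + d x z) \<le> 2 * (q + r) / (c + q + r)"
    proof (cases "d x z = 0")
      case False
      then have "0 < d x z" using nn by linarith
      then show ?thesis
        using nn tri mult_left_mono[OF tri(1) nn(1)] by (simp add: divide_simps algebra_simps)
    qed (use nn in simp)
    also have "\<dots> = 2 * q / (c + q + r) + 2 * r / (c + q + r)"
      by (simp add: add_divide_distrib)
    also have "\<dots> \<le> 2 * q / (d x a + d y a + q) + 2 * r / (d y a + d z a + r)"
      by (rule add_mono; rule weaken; use nn tri in \<open>simp add: c_def\<close>)
    finally show "2 * d x z / (d x a + d z a + d x z)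
        \<le> 2 * d x y / (d x a + d y a + d x y) + 2 * d y z / (d y a + d z a + d y z)"
      by (simp add: c_def q_def r_def)
  qed
qed

text \<open>Injectivity of \<open>f\<close> gives the zero axiom; the other axioms are inherited
  from \<open>d\<close>.\<close>

lemma Metric_space_pullback:
  assumes "Metric_space M d" "inj_on f S" "f ` S \<subseteq> M"
  shows "Metric_space S (\<lambda>x y. d (f x) (f y))"
proof -
  interpret Metric_space M d by fact
  show ?thesis
    using assms(2,3) by unfold_locales (auto simp: commute inj_on_eq_iff image_subset_iff intro: triangle)
qed

lemma Metric_space_l1:
  "Metric_space UNIV (\<lambda>U V :: real ^ 'd. \<Sum>j\<in>UNIV. \<bar>U $ j - V $ j\<bar>)"
proof
  fix U V W :: "real ^ 'd"
  show "0 \<le> (\<Sum>j\<in>UNIV. \<bar>U $ j - V $ j\<bar>)" by (simp add: sum_nonneg)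
  show "(\<Sum>j\<in>UNIV. \<bar>U $ j - V $ j\<bar>) = (\<Sum>j\<in>UNIV. \<bar>V $ j - U $ j\<bar>)"
    by (simp add: abs_minus_commute)
  show "(\<Sum>j\<in>UNIV. \<bar>U $ j - V $ j\<bar>) = 0 \<longleftrightarrow> U = V"
    by (simp add: sum_nonneg_eq_0_iff vec_eq_iff)
  show "(\<Sum>j\<in>UNIV. \<bar>U $ j - W $ j\<bar>)
      \<le> (\<Sum>j\<in>UNIV. \<bar>U $ j - V $ j\<bar>) + (\<Sum>j\<in>UNIV. \<bar>V $ j - W $ j\<bar>)"
    unfolding sum.distrib[symmetric] by (intro sum_mono) linarith
qed

lemma d_Tan_eq_Steinhaus:
  fixes U V :: "real ^ 'd"
  assumes U: "U \<in> nonneg_orthant" and V: "V \<in> nonneg_orthant"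
  defines "d \<equiv> \<lambda>X Y :: real ^ 'd. \<Sum>j\<in>UNIV. \<bar>X $ j - Y $ j\<bar>"
  shows "d_Tan U V = 2 * d U V / (d U 0 + d V 0 + d U V)"
proof -
  define mx mn where "mx = (\<Sum>j\<in>UNIV. max (U $ j) (V $ j))"
    and "mn = (\<Sum>j\<in>UNIV. min (U $ j) (V $ j))"
  have nn: "0 \<le> U $ j" "0 \<le> V $ j" for j
    using U V by (auto simp: nonneg_orthant_def)
  have num: "d U V = mx - mn"
    unfolding d_def mx_def mn_def sum_subtractf[symmetric] by (intro sum.cong) auto
  have den: "d U 0 + d V 0 + d U V = 2 * mx"
    unfolding d_def mx_def sum.distrib[symmetric] sum_distrib_left
    using nn by (intro sum.cong) (auto simp: max_def)
  have "0 \<le> mx"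
    unfolding mx_def using nn by (intro sum_nonneg) (auto simp: le_max_iff_disj)
  \<comment> \<open>If \<open>mx = 0\<close>, the quotient is 0 by division by zero, in agreement
    with \<open>J_Tan U V = 1\<close>.\<close>
  then show ?thesis
    unfolding den unfolding num d_Tan_def J_Tan_def mx_def[symmetric] mn_def[symmetric]
    by (simp add: field_simps)
qed

text \<open>Each coordinate is the difference of its positive and negative parts.\<close>

lemma inj_sign_split: "inj sign_split"
proof (rule injI)
  fix x y :: "real ^ 'n"
  assume eq: "sign_split x = sign_split y"
  have "x $ i = y $ i" for i
  proof -
    have "sign_split x $ (i, b) = sign_split y $ (i, b)" for b
      by (simp add: eq)
    from this[of True] this[of False] show ?thesis
      by (simp add: sign_split_def pos_part_def neg_part_def)
  qed
  then show "x = y" by (simp add: vec_eq_iff)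
qed

lemma sum_sign_index:
  fixes f :: "'n::finite \<times> bool \<Rightarrow> real"
  shows "(\<Sum>j\<in>UNIV. f j) = (\<Sum>i\<in>UNIV. f (i, True) + f (i, False))"
proof -
  have "(\<Sum>j\<in>UNIV. f j) = (\<Sum>i\<in>UNIV. \<Sum>b\<in>UNIV. f (i, b))"
    by (simp add: sum.cartesian_product)
  then show ?thesis by (simp add: UNIV_bool add.commute)
qed

lemma U_peak_eq_sum_max:
  "U_peak A B = (\<Sum>j\<in>UNIV. max (sign_split A $ j) (sign_split B $ j))"
  unfolding sum_sign_index by (simp add: U_peak_def sign_split_def)

text \<open>If \<open>A $ i\<close> and \<open>B $ i\<close> share a nonzero sign, one of the two
  minima at \<open>i\<close> is that of the absolute values and the other is 0. In all other cases
  each minimum has a zero argument and vanishes.\<close>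

lemma N_sign_eq_sum_min:
  "N_sign A B = (\<Sum>j\<in>UNIV. min (sign_split A $ j) (sign_split B $ j))"
proof -
  have "N_sign A B = (\<Sum>i\<in>UNIV. if i \<in> I_same A B then min \<bar>A $ i\<bar> \<bar>B $ i\<bar> else 0)"
    by (simp add: N_sign_def sum.If_cases)
  also have "\<dots> = (\<Sum>i\<in>UNIV. min (pos_part (A $ i)) (pos_part (B $ i))
      + min (neg_part (A $ i)) (neg_part (B $ i)))"
    by (intro sum.cong refl)
      (auto simp: I_same_def pos_part_def neg_part_def sgn_if min_def max_def split: if_splits)
  finally show ?thesis
    unfolding sum_sign_index by (simp add: sign_split_def)
qed

lemma d_peak_eq_d_Tan: "d_peak A B = d_Tan (sign_split A) (sign_split B)"
  by (simp add: d_peak_def J_peak_def d_Tan_def J_Tan_def U_peak_eq_sum_max N_sign_eq_sum_min)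

theorem theorem3p12:
  shows "(\<forall>A B :: real ^ 'n. d_peak A B = d_Tan (sign_split A) (sign_split B))
    \<and> Metric_space (UNIV :: (real ^ 'n) set) d_peak"
proof
  show "\<forall>A B :: real ^ 'n. d_peak A B = d_Tan (sign_split A) (sign_split B)"
    by (simp add: d_peak_eq_d_Tan)
  have "Metric_space UNIV (\<lambda>A B :: real ^ 'n. d_Tan (sign_split A) (sign_split B))"
    \<comment> \<open>The transformed l1 distance is a metric on the whole space; it agrees with
      \<open>d_Tan\<close> on the orthant, which contains the image of
      \<open>sign_split\<close>.\<close>
    using Metric_space_pullback[OF
        Metric_space_Steinhaus_transform[OF Metric_space_l1 UNIV_I[of 0]]
        inj_sign_split[where 'a = 'n] subset_UNIV]
    by (simp add: d_Tan_eq_Steinhaus sign_split_nonneg)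
  then show "Metric_space (UNIV :: (real ^ 'n) set) d_peak"
    by (simp flip: d_peak_eq_d_Tan)
qed

end
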